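(* There is no real-valued (the value $\infty$ being allowed) isomorphism invariant of measure-preserving dynamical systems that satisfies a variational principle with modified power entropy. That is, there is no function $h^*$ which assigns to every pair $(f,\mu)$, consisting of a continuous map $f:X\to X$ on a compact metric space $X$ and an $f$-invariant Borel probability measure $\mu$ on $X$, a value $h^*(f,\mu)\in\mathbb{R}\cup\{\infty\}$ such that $h^*(f,\mu)=h^*(g,\nu)$ whenever $(f,\mu)$ and $(g,\nu)$ are isomorphic as measure-preserving systems, and such that for all continuous maps $f$ on compact metric spaces $$h_{\mathrm{mod}}(f)=\sup_{\mu}h^*(f,\mu),$$ where the supremum is taken over all $f$-invariant Borel probability measures $\mu$. Here $h_{\mathrm{mod}}$ may be read throughout either as the upper modified power entropy $\overline{h}_{\mathrm{mod}}$ or as the lower modified power entropy $\underline{h}_{\mathrm{mod}}$; the statement holds for each of the two.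
   Context: For a continuous map $f:X\to X$ on a compact metric space $(X,d)$ and $n\in\mathbb{N}$, $n\ge1$, the Hamming metric is $\hat d_n^f(x,y)=\frac1n\sum_{i=0}^{n-1}d(f^i(x),f^i(y))$. A set $S\subseteq X$ is $\delta$-separated with respect to $\hat d_n^f$ if $\hat d_n^f(x,y)\geq\delta$ for all $x\neq y$ in $S$, and $\hat S_n(f,\delta)$ denotes the maximal cardinality of such a set. The modified power entropy of $f$ is $$h_{\mathrm{mod}}(f)=\lim_{\delta\to0}\lim_{n\to\infty}\frac{\log\hat S_n(f,\delta)}{\log n},$$ provided the limits as $n\to\infty$ exist; otherwise the upper and lower modified power entropies $\overline{h}_{\mathrm{mod}}(f)$ and $\underline{h}_{\mathrm{mod}}(f)$ are defined by replacing $\lim_{n\to\infty}$ with $\limsup_{n\to\infty}$ and $\liminf_{n\to\infty}$, respectively. Two systems $(f,\mu)$ on $X$ and $(g,\nu)$ on $Y$ are isomorphic as measure-preserving systems if there are measurable forward invariant sets $X_0\subseteq X$, $Y_0\subseteq Y$ of full measure and a bimeasurable bijection $\phi:X_0\to Y_0$ with $\phi_*\mu=\nu$ and $\phi\circ f=g\circ\phi$ on $X_0$. *)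

theory Defs
  imports "HOL-Probability.Probability"
begin

section \<open>Modified power entropy\<close>

definition top_system :: "'a metric \<Rightarrow> ('a \<Rightarrow> 'a) \<Rightarrow> bool" where
  "top_system X f \<longleftrightarrow>
     compact_space (mtopology_of X) \<and> mspace X \<noteq> {} \<and>
     continuous_map (mtopology_of X) (mtopology_of X) f"

definition hamming_dist :: "'a metric \<Rightarrow> ('a \<Rightarrow> 'a) \<Rightarrow> nat \<Rightarrow> 'a \<Rightarrow> 'a \<Rightarrow> real" where
  "hamming_dist X f n x y = (\<Sum>i<n. mdist X ((f ^^ i) x) ((f ^^ i) y)) / real n"

definition hamming_separated ::
  "'a metric \<Rightarrow> ('a \<Rightarrow> 'a) \<Rightarrow> nat \<Rightarrow> real \<Rightarrow> 'a set \<Rightarrow> bool" where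
  "hamming_separated X f n \<delta> S \<longleftrightarrow>
     S \<subseteq> mspace X \<and> (\<forall>x\<in>S. \<forall>y\<in>S. x \<noteq> y \<longrightarrow> hamming_dist X f n x y \<ge> \<delta>)"

text \<open>The maximum is taken over a finite set of numbers, and separated sets are finite;
  see \<open>hamming_separated_bounded\<close> below.\<close>

definition max_separated :: "'a metric \<Rightarrow> ('a \<Rightarrow> 'a) \<Rightarrow> nat \<Rightarrow> real \<Rightarrow> nat" where
  "max_separated X f n \<delta> = Max {card S |S. hamming_separated X f n \<delta> S}"

definition growth_rate :: "'a metric \<Rightarrow> ('a \<Rightarrow> 'a) \<Rightarrow> real \<Rightarrow> nat \<Rightarrow> ereal" where
  "growth_rate X f \<delta> n = ereal (ln (real (max_separated X f n \<delta>)) / ln (real n))"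

text \<open>The limits as \<open>\<delta>\<close> decreases to \<open>0\<close> always exist by monotonicity; see
  \<open>upper_mod_entropy_tendsto\<close> and \<open>lower_mod_entropy_tendsto\<close> below.\<close>

definition upper_mod_entropy :: "'a metric \<Rightarrow> ('a \<Rightarrow> 'a) \<Rightarrow> ereal" where
  "upper_mod_entropy X f = Lim (at_right 0) (\<lambda>\<delta>. limsup (growth_rate X f \<delta>))"

definition lower_mod_entropy :: "'a metric \<Rightarrow> ('a \<Rightarrow> 'a) \<Rightarrow> ereal" where
  "lower_mod_entropy X f = Lim (at_right 0) (\<lambda>\<delta>. liminf (growth_rate X f \<delta>))"


section \<open>Invariant measures and isomorphism\<close>

definition borel_on :: "'a metric \<Rightarrow> 'a measure" where
  "borel_on X = sigma (mspace X) {U. openin (mtopology_of X) U}"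

definition invariant_measures :: "'a metric \<Rightarrow> ('a \<Rightarrow> 'a) \<Rightarrow> 'a measure set" where
  "invariant_measures X f =
     {\<mu>. prob_space \<mu> \<and> sets \<mu> = sets (borel_on X) \<and> distr \<mu> \<mu> f = \<mu>}"

definition mps_isomorphic ::
  "('a \<Rightarrow> 'a) \<Rightarrow> 'a measure \<Rightarrow> ('b \<Rightarrow> 'b) \<Rightarrow> 'b measure \<Rightarrow> bool" where
  "mps_isomorphic f \<mu> g \<nu> \<longleftrightarrow>
     (\<exists>X0 Y0 \<phi>.
        X0 \<in> sets \<mu> \<and> emeasure \<mu> (space \<mu> - X0) = 0 \<and> f ` X0 \<subseteq> X0 \<and>
        Y0 \<in> sets \<nu> \<and> emeasure \<nu> (space \<nu> - Y0) = 0 \<and> g ` Y0 \<subseteq> Y0 \<and>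
        bij_betw \<phi> X0 Y0 \<and>
        \<phi> \<in> restrict_space \<mu> X0 \<rightarrow>\<^sub>M restrict_space \<nu> Y0 \<and>
        the_inv_into X0 \<phi> \<in> restrict_space \<nu> Y0 \<rightarrow>\<^sub>M restrict_space \<mu> X0 \<and>
        distr (restrict_space \<mu> X0) (restrict_space \<nu> Y0) \<phi> = restrict_space \<nu> Y0 \<and>
        (\<forall>x\<in>X0. \<phi> (f x) = g (\<phi> x)))"


section \<open>Invariants and the variational principle\<close>

text \<open>
  A function \<open>h\<close> that assigns a value to \<open>(f, \<mu>)\<close> for every system has to range over all compact
  metric spaces, which do not form a set. We let the points of the spaces be drawn from one type
  \<open>'a\<close>. If \<open>'a\<close> has at least the cardinality of the reals (for example, if it is \<open>real\<close>), this is
  no restriction: every compact metric space, over whatever type, then has an isometric copy whose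
  carrier is a subset of \<open>'a\<close>; see \<open>compact_metric_isometric_copy\<close> below.
  The space \<open>X\<close> is an explicit argument of \<open>h\<close>, as the HOL function \<open>f\<close> does not determine it.
\<close>

definition isomorphism_invariant ::
  "('a metric \<Rightarrow> ('a \<Rightarrow> 'a) \<Rightarrow> 'a measure \<Rightarrow> ereal) \<Rightarrow> bool" where
  "isomorphism_invariant h \<longleftrightarrow>
     (\<forall>X f \<mu> Y g \<nu>.
        top_system X f \<and> \<mu> \<in> invariant_measures X f \<and>
        top_system Y g \<and> \<nu> \<in> invariant_measures Y g \<and>
        mps_isomorphic f \<mu> g \<nu> \<longrightarrow> h X f \<mu> = h Y g \<nu>)"

definition avoids_minus_infinity ::
  "('a metric \<Rightarrow> ('a \<Rightarrow> 'a) \<Rightarrow> 'a measure \<Rightarrow> ereal) \<Rightarrow> bool" where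
  "avoids_minus_infinity h \<longleftrightarrow>
     (\<forall>X f \<mu>. top_system X f \<and> \<mu> \<in> invariant_measures X f \<longrightarrow> h X f \<mu> \<noteq> -\<infinity>)"

definition variational_principle ::
  "('a metric \<Rightarrow> ('a \<Rightarrow> 'a) \<Rightarrow> ereal) \<Rightarrow>
   ('a metric \<Rightarrow> ('a \<Rightarrow> 'a) \<Rightarrow> 'a measure \<Rightarrow> ereal) \<Rightarrow> bool" where
  "variational_principle h_top h \<longleftrightarrow>
     (\<forall>X f. top_system X f \<longrightarrow> h_top X f = (SUP \<mu>\<in>invariant_measures X f. h X f \<mu>))"


section \<open>Adequacy of the definitions\<close>

lemma continuous_map_iterate:
  assumes "continuous_map T T f"
  shows "continuous_map T T (f ^^ i)"
proof (induction i)
  case 0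
  then show ?case by (simp add: id_def)
next
  case (Suc i)
  then show ?case using continuous_map_compose[OF Suc assms] by (simp add: o_def)
qed

lemma iterate_in_mspace:
  assumes "top_system X f" "x \<in> mspace X"
  shows "(f ^^ i) x \<in> mspace X"
  using assms continuous_map_iterate[of "mtopology_of X" f i]
    continuous_map_image_subset_topspace[of "mtopology_of X" "mtopology_of X" "f ^^ i"]
  unfolding top_system_def topspace_mtopology_of by blast

lemma hamming_dist_commute: "hamming_dist X f n x y = hamming_dist X f n y x"
  by (simp add: hamming_dist_def mdist_commute)

lemma hamming_dist_triangle:
  assumes "top_system X f" "x \<in> mspace X" "y \<in> mspace X" "z \<in> mspace X"
  shows "hamming_dist X f n x z \<le> hamming_dist X f n x y + hamming_dist X f n y z"
  unfolding hamming_dist_def add_divide_distrib[symmetric] sum.distrib[symmetric]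
  by (intro divide_right_mono sum_mono mdist_triangle iterate_in_mspace assms) simp

lemma hamming_separated_bounded:
  assumes sys: "top_system X f" and "\<delta> > 0"
  shows "\<exists>N. \<forall>S. hamming_separated X f n \<delta> S \<longrightarrow> finite S \<and> card S \<le> N"
proof -
  let ?T = "mtopology_of X"
  define U where "U x = {y \<in> mspace X. hamming_dist X f n x y < \<delta> / 2}" for x
  have "openin ?T (U x)" if x: "x \<in> mspace X" for x
  proof -
    have "continuous_map ?T euclideanreal (\<lambda>y. mdist X ((f ^^ i) x) ((f ^^ i) y))" for i
    proof -
      have c: "continuous_map ?T ?T (f ^^ i)"
        using sys continuous_map_iterate by (auto simp: top_system_def)
      have "continuous_map ?T ?T (\<lambda>y. (f ^^ i) x)"
        using iterate_in_mspace[OF sys x] by simp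
      then show ?thesis
        using c by (rule continuous_map_mdist)
    qed
    then have "continuous_map ?T euclideanreal (hamming_dist X f n x)"
      unfolding hamming_dist_def[abs_def] divide_inverse
      by (intro continuous_map_real_mult continuous_map_sum) simp_all
    then have "openin ?T {y \<in> topspace ?T. hamming_dist X f n x y \<in> {..<\<delta> / 2}}"
      by (rule openin_continuous_map_preimage) simp
    then show ?thesis by (simp add: U_def)
  qed
  moreover have "x \<in> U x" if "x \<in> mspace X" for x
  proof -
    have "mdist X ((f ^^ i) x) ((f ^^ i) x) = 0" for i
      using iterate_in_mspace[OF sys that] by simp
    then show ?thesis using that assms(2) by (simp add: U_def hamming_dist_def)
  qed
  ultimately have cover: "\<forall>V\<in>U ` mspace X. openin ?T V" "topspace ?T \<subseteq> \<Union>(U ` mspace X)"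
    by auto
  have "compact_space ?T" using sys by (simp add: top_system_def)
  then obtain F where "finite F" "F \<subseteq> U ` mspace X" "topspace ?T \<subseteq> \<Union>F"
    using cover unfolding compact_space_alt by meson
  then obtain K where K: "finite K" "K \<subseteq> mspace X" "mspace X \<subseteq> \<Union>(U ` K)"
    using finite_subset_image[of F U "mspace X"] by auto
  have "finite S \<and> card S \<le> card K" if S: "hamming_separated X f n \<delta> S" for S
  proof -
    have "\<forall>s\<in>S. \<exists>k\<in>K. s \<in> U k"
      using S K by (auto simp: hamming_separated_def)
    then obtain c where c: "\<And>s. s \<in> S \<Longrightarrow> c s \<in> K \<and> s \<in> U (c s)" by metis
    have "inj_on c S"
    proof (rule inj_onI, rule ccontr)
      fix s t assume st: "s \<in> S" "t \<in> S" "c s = c t" "s \<noteq> t"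
      have "s \<in> mspace X" "t \<in> mspace X" "c s \<in> mspace X"
        using st c[of s] S K(2) by (auto simp: hamming_separated_def)
      then have "hamming_dist X f n s t \<le> hamming_dist X f n s (c s) + hamming_dist X f n (c s) t"
        by (intro hamming_dist_triangle[OF sys])
      also have "\<dots> < \<delta>"
        using c[of s] c[of t] st hamming_dist_commute[of X f n s "c s"] by (simp add: U_def)
      also have "\<delta> \<le> hamming_dist X f n s t"
        using S st unfolding hamming_separated_def by blast
      finally show False by simp
    qed
    moreover have "c ` S \<subseteq> K" using c by auto
    ultimately show ?thesis using inj_on_finite[of c S K] card_inj_on_le[of c S K] K(1) by blast
  qed
  then show ?thesis by blast
qed

lemma finite_separated_cards:
  assumes "top_system X f" "\<delta> > 0"
  shows "finite {card S |S. hamming_separated X f n \<delta> S}"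
proof -
  obtain N where "\<forall>S. hamming_separated X f n \<delta> S \<longrightarrow> finite S \<and> card S \<le> N"
    using hamming_separated_bounded[OF assms] by blast
  then have "{card S |S. hamming_separated X f n \<delta> S} \<subseteq> {..N}" by auto
  then show ?thesis by (rule finite_subset) simp
qed

lemma max_separated_pos:
  assumes "top_system X f" "\<delta> > 0"
  shows "max_separated X f n \<delta> \<ge> 1"
proof -
  obtain x where "x \<in> mspace X" using assms by (auto simp: top_system_def)
  then have "hamming_separated X f n \<delta> {x}" by (simp add: hamming_separated_def)
  then have "card {x} \<in> {card S |S. hamming_separated X f n \<delta> S}" by blast
  then have "card {x} \<le> Max {card S |S. hamming_separated X f n \<delta> S}"
    by (rule Max_ge[OF finite_separated_cards[OF assms]])
  then show ?thesis unfolding max_separated_def by simp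
qed

lemma max_separated_antimono:
  assumes "top_system X f" "0 < \<delta>" "\<delta> \<le> \<epsilon>"
  shows "max_separated X f n \<epsilon> \<le> max_separated X f n \<delta>"
  unfolding max_separated_def
proof (rule Max_mono)
  show "{card S |S. hamming_separated X f n \<epsilon> S} \<subseteq> {card S |S. hamming_separated X f n \<delta> S}"
    using assms(3) unfolding hamming_separated_def by fastforce
  have "hamming_separated X f n \<epsilon> {}" by (simp add: hamming_separated_def)
  then show "{card S |S. hamming_separated X f n \<epsilon> S} \<noteq> {}" by blast
qed (rule finite_separated_cards[OF assms(1,2)])

lemma growth_rate_antimono:
  assumes "top_system X f" "0 < \<delta>" "\<delta> \<le> \<epsilon>"
  shows "growth_rate X f \<epsilon> n \<le> growth_rate X f \<delta> n"
proof (cases "n = 0")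
  case False
  then show ?thesis
    using max_separated_pos[of X f \<epsilon> n] max_separated_antimono[OF assms, of n] assms
    unfolding growth_rate_def ereal_less_eq by (intro divide_right_mono) auto
qed (simp add: growth_rate_def)

lemma antimono_tendsto_at_right_0:
  fixes F :: "real \<Rightarrow> ereal"
  assumes "\<And>\<delta> \<epsilon>. 0 < \<delta> \<Longrightarrow> \<delta> \<le> \<epsilon> \<Longrightarrow> F \<epsilon> \<le> F \<delta>"
  shows "(F \<longlongrightarrow> (SUP \<delta>\<in>{0<..}. F \<delta>)) (at_right 0)"
proof (rule order_tendstoI)
  fix a assume "a < (SUP \<delta>\<in>{0<..}. F \<delta>)"
  then obtain \<epsilon> where e: "\<epsilon> > 0" "a < F \<epsilon>" by (auto simp: less_SUP_iff)
  then have "\<forall>\<^sub>F \<delta> in at_right 0. \<delta> \<in> {0<..<\<epsilon>}"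
    by (intro eventually_at_right_real)
  then show "\<forall>\<^sub>F \<delta> in at_right 0. a < F \<delta>"
  proof eventually_elim
    case (elim \<delta>)
    then have "F \<epsilon> \<le> F \<delta>" using assms by simp
    with e(2) show ?case by (rule less_le_trans)
  qed
next
  fix a assume a: "(SUP \<delta>\<in>{0<..}. F \<delta>) < a"
  have "\<forall>\<^sub>F \<delta> in at_right 0. \<delta> \<in> {0<..<1::real}"
    by (intro eventually_at_right_real) simp
  then show "\<forall>\<^sub>F \<delta> in at_right 0. F \<delta> < a"
  proof eventually_elim
    case (elim \<delta>)
    then have "F \<delta> \<le> (SUP \<delta>\<in>{0<..}. F \<delta>)" by (intro SUP_upper) simp
    then show ?case using a by (rule le_less_trans)
  qed
qed

lemma upper_mod_entropy_tendsto:
  assumes "top_system X f"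
  shows "((\<lambda>\<delta>. limsup (growth_rate X f \<delta>)) \<longlongrightarrow> upper_mod_entropy X f) (at_right 0)"
proof -
  have "((\<lambda>\<delta>. limsup (growth_rate X f \<delta>)) \<longlongrightarrow>
      (SUP \<delta>\<in>{0<..}. limsup (growth_rate X f \<delta>))) (at_right 0)"
    by (rule antimono_tendsto_at_right_0)
      (intro Limsup_mono always_eventually allI growth_rate_antimono[OF assms])
  then show ?thesis unfolding upper_mod_entropy_def
    by (simp add: tendsto_Lim)
qed

lemma lower_mod_entropy_tendsto:
  assumes "top_system X f"
  shows "((\<lambda>\<delta>. liminf (growth_rate X f \<delta>)) \<longlongrightarrow> lower_mod_entropy X f) (at_right 0)"
proof -
  have "((\<lambda>\<delta>. liminf (growth_rate X f \<delta>)) \<longlongrightarrow>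
      (SUP \<delta>\<in>{0<..}. liminf (growth_rate X f \<delta>))) (at_right 0)"
    by (rule antimono_tendsto_at_right_0)
      (intro Liminf_mono always_eventually allI growth_rate_antimono[OF assms])
  then show ?thesis unfolding lower_mod_entropy_def
    by (simp add: tendsto_Lim)
qed

lemma compact_metric_lepoll_reals:
  assumes "compact_space (mtopology_of X)"
  shows "mspace X \<lesssim> (UNIV :: real set)"
proof -
  interpret Metric_space "mspace X" "mdist X" by simp
  have tb: "mtotally_bounded (mspace X)"
    using assms compact_space_eq_mcomplete_mtotally_bounded by (simp add: mtopology_of_def)
  have "\<forall>n::nat. \<exists>K. finite K \<and> K \<subseteq> mspace X \<and> mspace X \<subseteq> (\<Union>x\<in>K. mball x (1 / Suc n))"
    using tb unfolding mtotally_bounded_def by (metis zero_less_divide_1_iff of_nat_0_less_iff zero_less_Suc)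
  then obtain K where K: "\<And>n::nat. finite (K n)" "\<And>n. K n \<subseteq> mspace X"
      "\<And>n. mspace X \<subseteq> (\<Union>x\<in>K n. mball x (1 / Suc n))"
    by metis
  define D where "D = (\<Union>n. K n)"
  define P where "P = D \<times> (UNIV :: nat set)"
  have "countable P" unfolding P_def D_def using K(1) by (auto intro: countable_finite)
  define code where "code x = {(c, n::nat). c \<in> K n \<and> mdist X c x < 1 / Suc n}" for x
  have "inj_on code (mspace X)"
  proof (rule inj_onI, rule ccontr)
    fix x y assume xy: "x \<in> mspace X" "y \<in> mspace X" "code x = code y" "x \<noteq> y"
    then have "mdist X x y > 0" by simp
    then obtain n where n: "1 / Suc n < mdist X x y / 2"
      by (metis half_gt_zero nat_approx_posE)
    obtain c where c: "c \<in> K n" "mdist X c x < 1 / Suc n"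
      using K(3)[of n] xy(1) by auto
    then have "(c, n) \<in> code y" using xy(3) by (auto simp: code_def)
    then have "mdist X c y < 1 / Suc n" by (simp add: code_def)
    moreover have "mdist X x y \<le> mdist X c x + mdist X c y"
      using c xy K(2)[of n] by (metis commute subsetD triangle)
    ultimately show False using c n by simp
  qed
  then have "mspace X \<lesssim> code ` mspace X" by (simp add: inj_on_image_lepoll_2)
  also have "code ` mspace X \<lesssim> Pow P"
    by (rule subset_imp_lepoll) (auto simp: code_def P_def D_def)
  also have "Pow P \<lesssim> Pow (UNIV :: nat set)"
  proof -
    obtain e :: "_ \<Rightarrow> nat" where "inj_on e P"
      using \<open>countable P\<close> by (auto simp: countable_def)
    then have "inj_on ((`) e) (Pow P)" by (rule inj_on_image_Pow)
    then show ?thesis by (auto simp: lepoll_def)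
  qed
  also have "Pow (UNIV :: nat set) \<lesssim> (UNIV :: real set)"
    using nat_sets_eqpoll_reals by (simp add: eqpoll_imp_lepoll)
  finally show ?thesis .
qed

lemma compact_metric_isometric_copy:
  fixes X :: "'b metric"
  assumes "compact_space (mtopology_of X)" "(UNIV :: real set) \<lesssim> (UNIV :: 'a set)"
  shows "\<exists>(Y :: 'a metric) \<iota>. bij_betw \<iota> (mspace X) (mspace Y) \<and>
           (\<forall>x\<in>mspace X. \<forall>y\<in>mspace X. mdist Y (\<iota> x) (\<iota> y) = mdist X x y)"
proof -
  have "mspace X \<lesssim> (UNIV :: 'a set)"
    using compact_metric_lepoll_reals[OF assms(1)] assms(2) by (rule lepoll_trans)
  then obtain \<iota> :: "'b \<Rightarrow> 'a" where i: "inj_on \<iota> (mspace X)"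
    by (auto simp: lepoll_def)
  define j where "j = the_inv_into (mspace X) \<iota>"
  have j: "j (\<iota> x) = x" if "x \<in> mspace X" for x
    using i that by (simp add: j_def the_inv_into_f_f)
  define d where "d a b = mdist X (j a) (j b)" for a b
  interpret Metric_space "\<iota> ` mspace X" d
  proof
    fix a b c
    show "0 \<le> d a b" "d a b = d b a" by (simp_all add: d_def mdist_commute)
    show "d a b = 0 \<longleftrightarrow> a = b" if "a \<in> \<iota> ` mspace X" "b \<in> \<iota> ` mspace X"
      using that j by (auto simp: d_def)
    show "d a c \<le> d a b + d b c"
      if "a \<in> \<iota> ` mspace X" "b \<in> \<iota> ` mspace X" "c \<in> \<iota> ` mspace X"
      using that j unfolding d_def by (intro mdist_triangle) auto
  qed
  have "bij_betw \<iota> (mspace X) (mspace (metric (\<iota> ` mspace X, d)))"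
    using i by (simp add: bij_betw_def)
  moreover have "\<forall>x\<in>mspace X. \<forall>y\<in>mspace X.
      mdist (metric (\<iota> ` mspace X, d)) (\<iota> x) (\<iota> y) = mdist X x y"
    by (simp add: d_def j)
  ultimately show ?thesis by blast
qed

end

(* If every orbit of f ends in a fixed point, then all invariant measures live on the set L of
   fixed points, where f agrees with the identity.  A variational principle with an isomorphism
   invariant would therefore give f at most the modified power entropy of the identity on L, which
   is 0.  The map (z, b, c) |-> (z exp(2 pi i min(b, c)), b, max(0, c - b^2)) on
   S^1 x [0,1] x [0,2] is of this kind: the clock c runs down to 0 unless b = 0.  Started at c = 2,
   it rotates by the full angle 2 pi b as long as c >= 1, that is for about 1/b^2 steps.  For
   b = j/n with j <= sqrt n these are at least n steps, and the resulting orbits of n-th roots of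
   unity are pairwise separated in the Hamming metric, so the entropy is at least 1/2. *)
theory Submission
  imports Defs
begin

section \<open>Transient systems and systems of fixed points\<close>

text \<open>The fixed points are the zeros of the continuous function
  \<open>mdist X (f x) x\<close>. Closedness makes this set both Borel and compact.\<close>

lemma closedin_fixed_points:
  assumes "top_system X f"
  shows "closedin (mtopology_of X) {x \<in> mspace X. f x = x}"
proof -
  have f: "continuous_map (mtopology_of X) (mtopology_of X) f"
    using assms by (simp add: top_system_def)
  have "continuous_map (mtopology_of X) euclideanreal (\<lambda>x. mdist X (f x) x)"
    using f by (rule continuous_map_mdist) simp
  then have "closedin (mtopology_of X) {x \<in> topspace (mtopology_of X). mdist X (f x) x \<in> {0}}"
    by (rule closedin_continuous_map_preimage) simp
  moreover have "{x \<in> topspace (mtopology_of X). mdist X (f x) x \<in> {0}} = {x \<in> mspace X. f x = x}"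
    using iterate_in_mspace[OF assms, of _ 1] by auto
  ultimately show ?thesis by simp
qed

section \<open>Borel sigma-algebras and subspaces\<close>

lemma openin_subset_Pow_mspace: "{U. openin (mtopology_of X) U} \<subseteq> Pow (mspace X)"
  using openin_subset[of "mtopology_of X"] by auto

lemma space_borel_on [simp]: "space (borel_on X) = mspace X"
  unfolding borel_on_def by (rule space_measure_of[OF openin_subset_Pow_mspace])

lemma sets_borel_on:
  "sets (borel_on X) = sigma_sets (mspace X) {U. openin (mtopology_of X) U}"
  unfolding borel_on_def by (rule sets_measure_of[OF openin_subset_Pow_mspace])

lemma closedin_sets_borel_on:
  assumes "closedin (mtopology_of X) C"
  shows "C \<in> sets (borel_on X)"
proof -
  have "mspace X - C \<in> sets (borel_on X)"
    using assms by (auto simp: sets_borel_on closedin_def intro!: sigma_sets.Basic)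
  then have "space (borel_on X) - (mspace X - C) \<in> sets (borel_on X)"
    by (rule sets.compl_sets)
  moreover have "C \<subseteq> mspace X"
    using closedin_subset[OF assms] by simp
  ultimately show ?thesis by (simp add: double_diff)
qed

text \<open>Open sets of the subspace are traces of open sets, and taking traces commutes with
  generating a sigma-algebra. Hence a Borel measure restricted to \<open>L\<close> is a Borel
  measure on the subspace.\<close>

lemma sets_borel_on_submetric:
  assumes "L \<in> sets (borel_on X)"
  shows "sets (borel_on (submetric X L)) = (\<inter>) L ` sets (borel_on X)"
proof -
  have L: "L \<subseteq> mspace X"
    using sets.sets_into_space[OF assms] by simp
  have "{U. openin (mtopology_of (submetric X L)) U} = (\<inter>) L ` {U. openin (mtopology_of X) U}"
    by (auto simp: mtopology_of_submetric openin_subtopology)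
  then have "sets (borel_on (submetric X L)) = sigma_sets L ((\<inter>) L ` {U. openin (mtopology_of X) U})"
    using L by (simp add: sets_borel_on Int_absorb2)
  also have "\<dots> = (\<inter>) L ` sigma_sets (mspace X) {U. openin (mtopology_of X) U}"
    using assms L by (intro sigma_sets_Int[symmetric]) (auto simp: sets_borel_on)
  finally show ?thesis by (simp add: sets_borel_on)
qed

lemma continuous_map_measurable_borel_on:
  assumes "continuous_map (mtopology_of X) (mtopology_of Y) f"
  shows "f \<in> borel_on X \<rightarrow>\<^sub>M borel_on Y"
proof -
  have "f -` U \<inter> mspace X \<in> sets (borel_on X)" if "openin (mtopology_of Y) U" for U
  proof -
    have "f -` U \<inter> mspace X = {x \<in> topspace (mtopology_of X). f x \<in> U}" by auto
    then show ?thesis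
      using openin_continuous_map_preimage[OF assms that] by (simp add: sets_borel_on)
  qed
  moreover have "f \<in> mspace X \<rightarrow> mspace Y"
    using continuous_map_image_subset_topspace[OF assms] by auto
  ultimately show ?thesis
    unfolding borel_on_def[of Y]
    by (intro measurable_measure_of openin_subset_Pow_mspace) auto
qed

section \<open>Invariant measures of a transient system\<close>

text \<open>The set is nonempty because some orbit ends in it, and compact because it is closed in a
  compact space.\<close>

lemma top_system_fixed_points:
  assumes sys: "top_system X f"
    and transient: "\<And>x. x \<in> mspace X \<Longrightarrow> \<exists>k. f ((f ^^ k) x) = (f ^^ k) x"
  shows "top_system (submetric X {x \<in> mspace X. f x = x}) (\<lambda>x. x)"
proof -
  let ?L = "{x \<in> mspace X. f x = x}"
  obtain x where "x \<in> mspace X" using sys by (auto simp: top_system_def)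
  with transient iterate_in_mspace[OF sys] have "?L \<noteq> {}" by blast
  moreover have "compactin (mtopology_of X) ?L"
    using closedin_fixed_points[OF sys] sys by (intro closedin_compact_space) (simp add: top_system_def)
  ultimately show ?thesis
    by (auto simp: top_system_def mtopology_of_submetric intro: compact_space_subtopology)
qed

text \<open>The preimages of the set \<open>L\<close> of fixed points increase to the whole space, and all of them
  have the measure of \<open>L\<close>.\<close>

lemma emeasure_non_fixed_points:
  assumes sys: "top_system X f" and \<mu>: "\<mu> \<in> invariant_measures X f"
    and transient: "\<And>x. x \<in> mspace X \<Longrightarrow> \<exists>k. f ((f ^^ k) x) = (f ^^ k) x"
  shows "emeasure \<mu> (space \<mu> - {x \<in> mspace X. f x = x}) = 0"
proof -
  let ?L = "{x \<in> mspace X. f x = x}"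
  interpret prob_space \<mu> using \<mu> by (simp add: invariant_measures_def)
  have sets_\<mu>: "sets \<mu> = sets (borel_on X)" and distr: "distr \<mu> \<mu> f = \<mu>"
    using \<mu> by (auto simp: invariant_measures_def)
  have space_\<mu>: "space \<mu> = mspace X" using sets_eq_imp_space_eq[OF sets_\<mu>] by simp
  have L: "?L \<in> sets \<mu>"
    using closedin_sets_borel_on[OF closedin_fixed_points[OF sys]] by (simp add: sets_\<mu>)
  have f: "f \<in> \<mu> \<rightarrow>\<^sub>M \<mu>"
    using continuous_map_measurable_borel_on[of X X f] sys
    by (simp add: top_system_def measurable_cong_sets[OF sets_\<mu> sets_\<mu>])
  define P where "P k = (f ^^ k) -` ?L \<inter> space \<mu>" for k
  \<comment> \<open>Splitting off the first application of \<open>f\<close> instead of the last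
    writes \<open>P (Suc k)\<close> as a preimage under \<open>f\<close>, so that invariance of
    \<open>\<mu>\<close> applies.\<close>
  have P_Suc: "P (Suc k) = f -` P k \<inter> space \<mu>" for k
    using measurable_space[OF f] by (auto simp: P_def funpow_swap1)
  have P: "P k \<in> sets \<mu> \<and> emeasure \<mu> (P k) = emeasure \<mu> ?L" for k
  proof (induction k)
    case 0
    have "P 0 = ?L" by (auto simp: P_def space_\<mu>)
    with L show ?case by simp
  next
    case (Suc k)
    then have "P (Suc k) \<in> sets \<mu>"
      unfolding P_Suc using f by (blast intro: measurable_sets)
    moreover have "emeasure \<mu> (P (Suc k)) = emeasure (distr \<mu> \<mu> f) (P k)"
      using Suc f by (simp add: P_Suc emeasure_distr)
    ultimately show ?case using Suc by (simp add: distr)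
  qed
  have L_P: "?L \<subseteq> P k" for k
  proof
    fix x assume x: "x \<in> ?L"
    then have "(f ^^ k) x = x" by (induction k) auto
    with x show "x \<in> P k" by (simp add: P_def space_\<mu>)
  qed
  \<comment> \<open>The two sets are nested and have the same finite measure.\<close>
  have "emeasure \<mu> (P k - ?L) = 0" for k
    using P[of k] L L_P[of k] by (subst emeasure_Diff) auto
  then have "P k - ?L \<in> null_sets \<mu>" for k
    using P[of k] L by (intro null_setsI) auto
  then have "(\<Union>k. P k - ?L) \<in> null_sets \<mu>" by (rule null_sets_UN)
  moreover have "(\<Union>k. P k - ?L) = space \<mu> - ?L"
    using transient iterate_in_mspace[OF sys] by (fastforce simp: P_def space_\<mu>)
  ultimately show ?thesis by auto
qed

text \<open>The isomorphism is the identity map with \<open>X0 = Y0 = L\<close>: the complement of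
  \<open>L\<close> is null, and on \<open>L\<close> the map \<open>f\<close> agrees with the
  identity.\<close>

lemma isomorphic_to_fixed_points:
  assumes sys: "top_system X f" and \<mu>: "\<mu> \<in> invariant_measures X f"
    and transient: "\<And>x. x \<in> mspace X \<Longrightarrow> \<exists>k. f ((f ^^ k) x) = (f ^^ k) x"
  defines "L \<equiv> {x \<in> mspace X. f x = x}"
  shows "restrict_space \<mu> L \<in> invariant_measures (submetric X L) (\<lambda>x. x)"
    and "mps_isomorphic f \<mu> (\<lambda>x. x) (restrict_space \<mu> L)"
proof -
  interpret prob_space \<mu> using \<mu> by (simp add: invariant_measures_def)
  have sets_\<mu>: "sets \<mu> = sets (borel_on X)"
    using \<mu> by (auto simp: invariant_measures_def)
  have L_borel: "L \<in> sets (borel_on X)"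
    unfolding L_def by (rule closedin_sets_borel_on[OF closedin_fixed_points[OF sys]])
  then have L: "L \<in> sets \<mu>" by (simp add: sets_\<mu>)
  have null: "emeasure \<mu> (space \<mu> - L) = 0"
    unfolding L_def by (rule emeasure_non_fixed_points[OF sys \<mu> transient])
  then have "prob L = 1"
    using prob_compl[OF L] by (simp add: measure_def)
  then have "prob_space (restrict_space \<mu> L)"
    using L by (intro prob_space_restrict_space) (simp_all add: emeasure_eq_measure)
  moreover have "sets (restrict_space \<mu> L) = sets (borel_on (submetric X L))"
    by (simp add: sets_restrict_space sets_\<mu> sets_borel_on_submetric[OF L_borel])
  ultimately show "restrict_space \<mu> L \<in> invariant_measures (submetric X L) (\<lambda>x. x)"
    by (simp add: invariant_measures_def distr_id2)
  \<comment> \<open>\<open>mps_isomorphic\<close> restricts the target measure to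
    \<open>Y0 = L\<close> a second time.\<close>
  have "restrict_space (restrict_space \<mu> L) L = restrict_space \<mu> L"
    using L by (subst restrict_restrict_space) auto
  moreover have "the_inv_into L (\<lambda>x. x) \<in> restrict_space \<mu> L \<rightarrow>\<^sub>M restrict_space \<mu> L"
  proof (subst measurable_cong)
    show "the_inv_into L (\<lambda>x. x) x = x" if "x \<in> space (restrict_space \<mu> L)" for x
      using that L the_inv_into_f_f[of "\<lambda>x. x" L x] by simp
  qed simp
  moreover have "L \<in> sets (restrict_space \<mu> L)"
    using L by (simp add: sets_restrict_space_iff)
  ultimately show "mps_isomorphic f \<mu> (\<lambda>x. x) (restrict_space \<mu> L)"
    unfolding mps_isomorphic_def using L null
    by (intro exI[of _ L] exI[of _ "\<lambda>x. x"])
      (auto simp: L_def distr_id2 bij_betw_def)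
qed

section \<open>Entropy of the identity and the resulting upper bound\<close>

text \<open>For the identity every Hamming metric with \<open>n > 0\<close> is the original metric,
  so the numerator of the growth rate is constant while \<open>ln n\<close> tends to
  infinity.\<close>

lemma growth_rate_identity_tendsto:
  fixes X :: "'a metric"
  shows "growth_rate X (\<lambda>x. x) \<delta> \<longlonglongrightarrow> 0"
proof -
  define c where "c = ln (real (max_separated X (\<lambda>x. x) 1 \<delta>))"
  have "(\<lambda>n. c / ln (real n)) \<longlonglongrightarrow> 0"
    by (intro tendsto_divide_0[OF tendsto_const] filterlim_at_top_imp_at_infinity
        filterlim_compose[OF ln_at_top filterlim_real_sequentially])
  then have "(\<lambda>n. ereal (c / ln (real n))) \<longlonglongrightarrow> ereal 0" by simp
  \<comment> \<open>The index 0 is left out: there division by zero makes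
    \<open>hamming_dist\<close> vanish.\<close>
  moreover have "\<forall>\<^sub>F n in sequentially. ereal (c / ln (real n)) = growth_rate X (\<lambda>x. x) \<delta> n"
    using eventually_gt_at_top[of 0]
  proof eventually_elim
    case (elim n)
    have "(\<lambda>x. x) ^^ i = (\<lambda>x. x :: 'a)" for i by (induction i) (auto simp: fun_eq_iff)
    with elim show ?case
      by (simp add: c_def growth_rate_def max_separated_def hamming_separated_def hamming_dist_def)
  qed
  ultimately show ?thesis unfolding zero_ereal_def by (rule Lim_transform_eventually)
qed

lemma mod_entropy_identity:
  assumes "top_system X (\<lambda>x. x)" "h_mod \<in> {upper_mod_entropy, lower_mod_entropy}"
  shows "h_mod X (\<lambda>x. x) = 0"
proof -
  have "limsup (growth_rate X (\<lambda>x. x) \<delta>) = 0" "liminf (growth_rate X (\<lambda>x. x) \<delta>) = 0" for \<delta>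
    using lim_imp_Limsup[OF _ growth_rate_identity_tendsto, of X \<delta>]
      lim_imp_Liminf[OF _ growth_rate_identity_tendsto, of X \<delta>] by simp_all
  then have "((\<lambda>\<delta>. 0) \<longlongrightarrow> h_mod X (\<lambda>x. x)) (at_right (0::real))"
    using upper_mod_entropy_tendsto[OF assms(1)] lower_mod_entropy_tendsto[OF assms(1)] assms(2)
    by auto
  then show ?thesis
    using tendsto_unique[OF _ tendsto_const] by (metis trivial_limit_at_right_real)
qed

text \<open>Each invariant measure of \<open>f\<close> gets the same value as a measure of the
  identity on \<open>L\<close>. The variational principle on \<open>L\<close> bounds that value by
  the entropy of the identity, and the principle on \<open>X\<close> turns this into a bound for
  \<open>f\<close>.\<close>

lemma mod_entropy_transient_le_0:
  assumes sys: "top_system X f"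
    and transient: "\<And>x. x \<in> mspace X \<Longrightarrow> \<exists>k. f ((f ^^ k) x) = (f ^^ k) x"
    and h_mod: "h_mod \<in> {upper_mod_entropy, lower_mod_entropy}"
    and h: "isomorphism_invariant h" "variational_principle h_mod h"
  shows "h_mod X f \<le> 0"
proof -
  define L where "L = {x \<in> mspace X. f x = x}"
  let ?Y = "submetric X L"
  have Y: "top_system ?Y (\<lambda>x. x)"
    unfolding L_def by (rule top_system_fixed_points[OF sys transient])
  have "h X f \<mu> \<le> 0" if \<mu>: "\<mu> \<in> invariant_measures X f" for \<mu>
  proof -
    note iso = isomorphic_to_fixed_points[OF sys \<mu> transient, folded L_def]
    have "h X f \<mu> = h ?Y (\<lambda>x. x) (restrict_space \<mu> L)"
      using h(1) sys \<mu> Y iso unfolding isomorphism_invariant_def by blast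
    also have "\<dots> \<le> (SUP \<nu>\<in>invariant_measures ?Y (\<lambda>x. x). h ?Y (\<lambda>x. x) \<nu>)"
      using iso by (intro SUP_upper)
    also have "\<dots> = h_mod ?Y (\<lambda>x. x)"
      using h(2) Y by (simp add: variational_principle_def)
    also have "\<dots> = 0" by (rule mod_entropy_identity[OF Y h_mod])
    finally show ?thesis .
  qed
  then have "(SUP \<mu>\<in>invariant_measures X f. h X f \<mu>) \<le> 0" by (rule SUP_least)
  then show ?thesis using h(2) sys by (simp add: variational_principle_def)
qed

section \<open>Lower bounds and isometric copies\<close>

text \<open>By monotonicity a bound at one scale passes to all smaller scales and survives the
  limit. Obtained for the liminf, it also holds for the limsup.\<close>

lemma mod_entropy_ge:
  assumes sys: "top_system X f" and "\<delta> > 0"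
    and bound: "\<forall>\<^sub>F n in sequentially. c \<le> growth_rate X f \<delta> n"
    and h_mod: "h_mod \<in> {upper_mod_entropy, lower_mod_entropy}"
  shows "c \<le> h_mod X f"
proof -
  have ev: "\<forall>\<^sub>F \<epsilon> in at_right 0. c \<le> liminf (growth_rate X f \<epsilon>)"
    using eventually_at_right_real[OF \<open>\<delta> > 0\<close>]
  proof eventually_elim
    case (elim \<epsilon>)
    have "\<forall>\<^sub>F n in sequentially. c \<le> growth_rate X f \<epsilon> n"
      using bound
    proof eventually_elim
      case (elim n)
      also have "growth_rate X f \<delta> n \<le> growth_rate X f \<epsilon> n"
        using \<open>\<epsilon> \<in> {0<..<\<delta>}\<close> by (intro growth_rate_antimono[OF sys]) auto
      finally show ?case .
    qed
    then show ?case by (rule Liminf_bounded)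
  qed
  have "\<forall>\<^sub>F \<epsilon> in at_right 0. c \<le> limsup (growth_rate X f \<epsilon>)"
    using ev
    by eventually_elim (rule order_trans, assumption, rule Liminf_le_Limsup, simp)
  with ev show ?thesis
    using tendsto_lowerbound[OF upper_mod_entropy_tendsto[OF sys]]
      tendsto_lowerbound[OF lower_mod_entropy_tendsto[OF sys]] h_mod
    by (auto simp: trivial_limit_at_right_real)
qed

lemma card_le_max_separated:
  assumes "top_system X f" "\<delta> > 0" "hamming_separated X f n \<delta> S"
  shows "card S \<le> max_separated X f n \<delta>"
  unfolding max_separated_def
  using assms(3) by (intro Max_ge[OF finite_separated_cards[OF assms(1,2)]]) blast

text \<open>The invariant sees only spaces with points in \<open>'a\<close>, so a concrete system is
  moved there by conjugating \<open>F\<close> with an isometry. This preserves Hamming distances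
  along orbits.\<close>

lemma isometric_copy_of_system:
  fixes X :: "'b metric"
  assumes sys: "top_system X F" and "(UNIV :: real set) \<lesssim> (UNIV :: 'a set)"
  obtains Y :: "'a metric" and f \<iota> where "top_system Y f" "bij_betw \<iota> (mspace X) (mspace Y)"
    "\<And>x y. x \<in> mspace X \<Longrightarrow> y \<in> mspace X \<Longrightarrow> mdist Y (\<iota> x) (\<iota> y) = mdist X x y"
    "\<And>x k. x \<in> mspace X \<Longrightarrow> (f ^^ k) (\<iota> x) = \<iota> ((F ^^ k) x)"
proof -
  obtain Y :: "'a metric" and \<iota> where bij: "bij_betw \<iota> (mspace X) (mspace Y)"
    and iso: "\<And>x y. x \<in> mspace X \<Longrightarrow> y \<in> mspace X \<Longrightarrow> mdist Y (\<iota> x) (\<iota> y) = mdist X x y"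
    using compact_metric_isometric_copy[of X] assms unfolding top_system_def by metis
  define j where "j = the_inv_into (mspace X) \<iota>"
  have j: "j (\<iota> x) = x" if "x \<in> mspace X" for x
    using bij that by (simp add: j_def bij_betw_def the_inv_into_f_f)
  have img: "\<iota> ` mspace X = mspace Y" using bij by (simp add: bij_betw_def)
  have "Lipschitz_continuous_map X Y \<iota>"
    unfolding Lipschitz_continuous_map_def
    using iso img by (intro conjI exI[of _ 1]) auto
  moreover have "Lipschitz_continuous_map Y X j"
    unfolding Lipschitz_continuous_map_def img[symmetric]
    using iso j by (intro conjI exI[of _ 1]) auto
  ultimately have cont: "continuous_map (mtopology_of X) (mtopology_of Y) \<iota>"
      "continuous_map (mtopology_of Y) (mtopology_of X) j"
    by (auto intro: Lipschitz_continuous_imp_continuous_map)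
  define f where "f = \<iota> \<circ> F \<circ> j"
  have "continuous_map (mtopology_of Y) (mtopology_of Y) f"
    unfolding f_def using cont sys by (auto simp: top_system_def intro!: continuous_map_compose)
  moreover have "compactin (mtopology_of Y) (\<iota> ` mspace X)"
    using sys cont(1) by (intro image_compactin) (auto simp: top_system_def compact_space_def)
  ultimately have "top_system Y f"
    using sys img by (auto simp: top_system_def compact_space_def)
  moreover have "(f ^^ k) (\<iota> x) = \<iota> ((F ^^ k) x)" if "x \<in> mspace X" for x k
    using iterate_in_mspace[OF sys that] j by (induction k) (auto simp: f_def)
  ultimately show thesis using that bij iso by blast
qed

section \<open>The twist system\<close>

text \<open>For nonnegative \<open>b\<close> and \<open>c\<close> the factor \<open>min b c\<close>
  vanishes exactly if \<open>b = 0\<close> or \<open>c = 0\<close>. Hence a stopped clock leaves the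
  point fixed, and the rotation dies out continuously.\<close>

definition twist :: "complex \<times> real \<times> real \<Rightarrow> complex \<times> real \<times> real" where
  "twist = (\<lambda>(z, b, c). (z * cis (2 * pi * min b c), b, max 0 (c - b\<^sup>2)))"

definition twist_space :: "(complex \<times> real \<times> real) metric" where
  "twist_space = submetric euclidean_metric (sphere 0 1 \<times> {0..1} \<times> {0..2})"

lemma mspace_twist_space: "mspace twist_space = sphere 0 1 \<times> {0..1} \<times> {0..2}"
  by (simp add: twist_space_def)

lemma mdist_twist_space: "mdist twist_space = dist"
  by (simp add: twist_space_def)

lemma top_system_twist: "top_system twist_space twist"
  unfolding top_system_def
proof (intro conjI)
  let ?C = "sphere 0 1 \<times> {0..1} \<times> {0..2} :: (complex \<times> real \<times> real) set"
  have top: "mtopology_of twist_space = top_of_set ?C"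
    by (simp add: twist_space_def mtopology_of_submetric)
  have "compact ?C" by (intro compact_Times) auto
  then show "compact_space (mtopology_of twist_space)"
    unfolding top by (intro compact_space_subtopology) simp
  have "(1, 0, 0) \<in> ?C" by simp
  then show "mspace twist_space \<noteq> {}" unfolding mspace_twist_space by blast
  have "continuous_on ?C twist"
    unfolding twist_def case_prod_beta by (intro continuous_intros)
  moreover have "c - b\<^sup>2 \<le> 2" if "c \<le> 2" for b c :: real
    using that zero_le_power2[of b] by linarith
  then have "twist ` ?C \<subseteq> ?C"
    by (auto simp: twist_def norm_mult)
  ultimately show "continuous_map (mtopology_of twist_space) (mtopology_of twist_space) twist"
    unfolding top by auto
qed

lemma snd_twist_iterate:
  assumes "0 \<le> c"
  shows "snd ((twist ^^ k) (z, b, c)) = (b, max 0 (c - real k * b\<^sup>2))"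
proof (induction k)
  case (Suc k)
  \<comment> \<open>Truncating at 0 in every step amounts to truncating once at the end, as the
    decrements are nonnegative.\<close>
  have "max 0 (max 0 (c - real k * b\<^sup>2) - b\<^sup>2) = max 0 (c - real (Suc k) * b\<^sup>2)"
    unfolding of_nat_Suc distrib_right using zero_le_power2[of b] by linarith
  with Suc show ?case by (cases "(twist ^^ k) (z, b, c)") (auto simp: twist_def)
qed (use assms in simp)

text \<open>For \<open>b = 0\<close> the point is fixed from the start. Otherwise the clock is at 0
  after at least \<open>c / b\<^sup>2\<close> steps, and the rotation has stopped.\<close>

lemma twist_transient:
  assumes "x \<in> mspace twist_space"
  shows "\<exists>k. twist ((twist ^^ k) x) = (twist ^^ k) x"
proof -
  obtain z b c where x: "x = (z, b, c)" by (cases x)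
  have bc: "0 \<le> b" "0 \<le> c" using assms by (auto simp: x mspace_twist_space)
  show ?thesis
  proof (cases "b = 0")
    case True
    then have "twist ((twist ^^ 0) x) = (twist ^^ 0) x"
      using bc by (simp add: x twist_def)
    then show ?thesis by blast
  next
    case False
    then have b2: "b\<^sup>2 > 0" by simp
    obtain k :: nat where "c / b\<^sup>2 \<le> real k" using real_arch_simple by blast
    then have "c \<le> real k * b\<^sup>2" using b2 by (simp add: divide_le_eq)
    then have "snd ((twist ^^ k) x) = (b, 0)"
      using snd_twist_iterate[OF bc(2), of k z b] by (simp add: x)
    then have "twist ((twist ^^ k) x) = (twist ^^ k) x"
      using bc by (cases "(twist ^^ k) x") (auto simp: twist_def)
    then show ?thesis by blast
  qed
qed

section \<open>Separated orbits of roots of unity\<close>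

text \<open>Up to time \<open>k\<close> the clock, started at 2, reads at least
  \<open>2 - k * b\<^sup>2 \<ge> 1 \<ge> b\<close>, so \<open>min\<close> selects \<open>b\<close>
  and every step rotates by the full angle.\<close>

lemma fst_twist_iterate:
  assumes "0 \<le> b" "b \<le> 1" "real k * b\<^sup>2 \<le> 1"
  shows "fst ((twist ^^ k) (1, b, 2)) = cis (2 * pi * b) ^ k"
  using assms(3)
proof (induction k)
  case (Suc k)
  have le: "real k * b\<^sup>2 \<le> 1"
    using Suc.prems by (simp add: algebra_simps) (smt (verit) zero_le_power2)
  then have "min b (max 0 (2 - real k * b\<^sup>2)) = b"
    using assms by auto
  with Suc.IH[OF le] snd_twist_iterate[of 2 k 1 b] show ?case
    by (cases "(twist ^^ k) (1, b, 2)") (auto simp: twist_def)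
qed simp

text \<open>On the unit circle \<open>\<bar>u - v\<bar> = \<bar>1 - u / v\<bar> \<ge> 1 - Re (u / v)\<close>, and the powers of the nontrivial
  root of unity \<open>u / v\<close> sum to zero.\<close>

lemma sum_dist_powers_of_roots_of_unity:
  fixes u v :: complex
  assumes "norm u = 1" "norm v = 1" "u ^ n = 1" "v ^ n = 1" "u \<noteq> v"
  shows "real n \<le> (\<Sum>i<n. dist (u ^ i) (v ^ i))"
proof -
  define w where "w = u / v"
  have v: "v \<noteq> 0" using assms(2) by auto
  have w: "w \<noteq> 1" "w ^ n = 1" "norm w = 1"
    using assms v by (auto simp: w_def power_divide norm_divide)
  have "1 - Re (w ^ i) \<le> dist (u ^ i) (v ^ i)" for i
  proof -
    have "1 - Re (w ^ i) \<le> norm (1 - w ^ i)"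
      using complex_Re_le_cmod[of "1 - w ^ i"] by simp
    also have "\<dots> = norm (v ^ i) * norm (1 - w ^ i)"
      by (simp add: norm_power assms)
    also have "\<dots> = norm (v ^ i - u ^ i)"
      using v by (simp add: norm_mult[symmetric] w_def right_diff_distrib power_divide)
    finally show ?thesis by (simp add: dist_norm norm_minus_commute)
  qed
  then have "(\<Sum>i<n. 1 - Re (w ^ i)) \<le> (\<Sum>i<n. dist (u ^ i) (v ^ i))" by (intro sum_mono)
  moreover have "(\<Sum>i<n. w ^ i) = 0" using w by (simp add: geometric_sum)
  then have "(\<Sum>i<n. Re (w ^ i)) = 0" by (simp flip: Re_sum)
  ultimately show ?thesis by (simp add: sum_subtractf)
qed

lemma cis_root_of_unity_inj:
  assumes "j < n" "k < n" "cis (2 * pi * (real j / real n)) = cis (2 * pi * (real k / real n))"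
  shows "j = k"
  using inj_onD[OF bij_betw_imp_inj_on[OF Complex.bij_betw_roots_unity[of n]], of j k] assms by simp

text \<open>During these \<open>n\<close> steps the circle coordinates run through the powers of two
  distinct \<open>n\<close>-th roots of unity, whose average distance is at least 1.\<close>

lemma hamming_dist_twist:
  assumes "n \<ge> 1" "j < n" "k < n" "j\<^sup>2 \<le> n" "k\<^sup>2 \<le> n" "j \<noteq> k"
  shows "1 \<le> hamming_dist twist_space twist n (1, real j / real n, 2) (1, real k / real n, 2)"
proof -
  let ?x = "\<lambda>j. (1 :: complex, real j / real n, 2 :: real)" and ?u = "\<lambda>j. cis (2 * pi * (real j / real n))"
  have fst: "fst ((twist ^^ i) (?x j)) = ?u j ^ i" if j: "j < n" "j\<^sup>2 \<le> n" and "i < n" for i j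
  proof (rule fst_twist_iterate)
    have "real j ^ 2 \<le> real n" using j(2) by (metis of_nat_le_iff of_nat_power)
    then have "real i * (real j)\<^sup>2 \<le> real n * real n"
      using that by (intro mult_mono) auto
    then show "real i * (real j / real n)\<^sup>2 \<le> 1"
      using assms(1) by (simp add: power_divide divide_le_eq power2_eq_square)
  qed (use that in auto)
  have "?u j ^ n = 1" if "j < n" for j
    using bij_betw_apply[OF Complex.bij_betw_roots_unity[of n], of j] that by simp
  then have "real n \<le> (\<Sum>i<n. dist (?u j ^ i) (?u k ^ i))"
    using assms cis_root_of_unity_inj by (intro sum_dist_powers_of_roots_of_unity) auto
  \<comment> \<open>Projection to the circle coordinate does not increase distances.\<close>
  also have "\<dots> \<le> (\<Sum>i<n. dist ((twist ^^ i) (?x j)) ((twist ^^ i) (?x k)))"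
    using assms fst by (intro sum_mono) (metis dist_fst_le lessThan_iff)
  finally show ?thesis
    using assms(1) by (simp add: hamming_dist_def mdist_twist_space le_divide_eq)
qed

lemma ex_twist_separated:
  assumes "n \<ge> 2"
  shows "\<exists>S. hamming_separated twist_space twist n 1 S \<and> finite S \<and> sqrt (real n) \<le> real (card S)"
proof -
  define J where "J = {j. j\<^sup>2 \<le> n}"
  define x where "x j = (1 :: complex, real j / real n, 2 :: real)" for j
  \<comment> \<open>This fails for \<open>n = 1\<close>, where \<open>j = 1\<close> satisfies
    \<open>j\<^sup>2 \<le> n\<close>. The strict inequality matters because \<open>j = 0\<close> and
    \<open>j = n\<close> give the same root of unity.\<close>
  have less: "j < n" if "j \<in> J" for j
  proof (rule ccontr)
    assume "\<not> j < n"
    then have "2 * j \<le> j * j" using assms by (intro mult_right_mono) auto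
    moreover have "j * j \<le> n" using that by (simp add: J_def power2_eq_square)
    ultimately show False using assms \<open>\<not> j < n\<close> by linarith
  qed
  have "J \<subseteq> {..<n}" using less by auto
  then have "finite J" by (rule finite_subset) simp
  have inj: "inj_on x J" using assms by (auto simp: inj_on_def x_def)
  define m where "m = nat \<lfloor>sqrt (real n)\<rfloor>"
  have "{..m} \<subseteq> J"
  proof
    fix j assume "j \<in> {..m}"
    then have "real j \<le> sqrt (real n)" by (simp add: m_def le_nat_iff le_floor_iff)
    then have "(real j)\<^sup>2 \<le> (sqrt (real n))\<^sup>2" by (intro power_mono) auto
    then show "j \<in> J" by (simp add: J_def flip: of_nat_power)
  qed
  \<comment> \<open>Counting from 0 gives \<open>m + 1\<close> indices, which makes up for the
    rounding in \<open>m\<close>.\<close>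
  then have "m + 1 \<le> card J"
    using card_mono[OF \<open>finite J\<close>, of "{..m}"] by simp
  moreover have "sqrt (real n) \<le> real m + 1" unfolding m_def by linarith
  ultimately have "sqrt (real n) \<le> real (card (x ` J))"
    using inj by (simp add: card_image)
  moreover have "hamming_separated twist_space twist n 1 (x ` J)"
    unfolding hamming_separated_def
  proof (intro conjI ballI impI)
    show "x ` J \<subseteq> mspace twist_space"
      using less by (force simp: mspace_twist_space x_def)
    fix p q assume "p \<in> x ` J" "q \<in> x ` J" "p \<noteq> q"
    then show "1 \<le> hamming_dist twist_space twist n p q"
      using less assms hamming_dist_twist[of n] by (auto simp: x_def J_def)
  qed
  ultimately show ?thesis using \<open>finite J\<close> by blast
qed

theorem corollary5p2:
  assumes "(UNIV :: real set) \<lesssim> (UNIV :: 'a set)"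
  shows "\<forall>h_mod \<in> {upper_mod_entropy, lower_mod_entropy}.
    \<not> (\<exists>h :: 'a metric \<Rightarrow> ('a \<Rightarrow> 'a) \<Rightarrow> 'a measure \<Rightarrow> ereal.
          avoids_minus_infinity h \<and> isomorphism_invariant h \<and> variational_principle h_mod h)"
proof (intro ballI notI, elim exE conjE)
  fix h_mod :: "'a metric \<Rightarrow> ('a \<Rightarrow> 'a) \<Rightarrow> ereal" and h
  assume h_mod: "h_mod \<in> {upper_mod_entropy, lower_mod_entropy}"
    and h: "isomorphism_invariant h" "variational_principle h_mod h"
  obtain Y :: "'a metric" and f \<iota> where Y: "top_system Y f"
    and bij: "bij_betw \<iota> (mspace twist_space) (mspace Y)"
    and iso: "\<And>x y. x \<in> mspace twist_space \<Longrightarrow> y \<in> mspace twist_space \<Longrightarrow>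
      mdist Y (\<iota> x) (\<iota> y) = mdist twist_space x y"
    and conj: "\<And>x k. x \<in> mspace twist_space \<Longrightarrow> (f ^^ k) (\<iota> x) = \<iota> ((twist ^^ k) x)"
    by (rule isometric_copy_of_system[OF top_system_twist assms]) (rule that)
  have "\<exists>k. f ((f ^^ k) y) = (f ^^ k) y" if "y \<in> mspace Y" for y
  proof -
    have "y \<in> \<iota> ` mspace twist_space"
      using that bij_betw_imp_surj_on[OF bij] by simp
    then obtain x where x: "x \<in> mspace twist_space" "y = \<iota> x"
      by (rule imageE)
    \<comment> \<open>Written with \<open>Suc k\<close>, both sides are iterates, so
      \<open>conj\<close> carries the equation over to \<open>f\<close>.\<close>
    obtain k where "(twist ^^ Suc k) x = (twist ^^ k) x"
      using twist_transient[OF x(1)] by auto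
    then have "(f ^^ Suc k) y = (f ^^ k) y"
      by (simp only: x(2) conj[OF x(1)])
    then show ?thesis by auto
  qed
  then have "h_mod Y f \<le> 0"
    using mod_entropy_transient_le_0[OF Y _ h_mod h] by blast
  moreover have "ereal (1 / 2) \<le> h_mod Y f"
  proof (rule mod_entropy_ge[OF Y zero_less_one _ h_mod])
    show "\<forall>\<^sub>F n in sequentially. ereal (1 / 2) \<le> growth_rate Y f 1 n"
      using eventually_ge_at_top[of 2]
    proof eventually_elim
      case (elim n)
      then obtain S where S: "hamming_separated twist_space twist n 1 S" "finite S"
          "sqrt (real n) \<le> real (card S)"
        using ex_twist_separated by blast
      have sub: "S \<subseteq> mspace twist_space" using S by (simp only: hamming_separated_def)
      have dist: "hamming_dist Y f n (\<iota> x) (\<iota> y) = hamming_dist twist_space twist n x y"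
        if "x \<in> S" "y \<in> S" for x y
      proof -
        have "x \<in> mspace twist_space" "y \<in> mspace twist_space" using that sub by auto
        then show ?thesis
          by (simp only: hamming_dist_def conj iso iterate_in_mspace[OF top_system_twist])
      qed
      have "hamming_separated Y f n 1 (\<iota> ` S)"
        unfolding hamming_separated_def
      proof (intro conjI ballI impI)
        show "\<iota> ` S \<subseteq> mspace Y"
          using image_mono[OF sub, of \<iota>] bij_betw_imp_surj_on[OF bij] by simp
        fix p q assume "p \<in> \<iota> ` S" "q \<in> \<iota> ` S" "p \<noteq> q"
        then obtain x y where xy: "x \<in> S" "y \<in> S" "p = \<iota> x" "q = \<iota> y" by (elim imageE)
        with \<open>p \<noteq> q\<close> have "x \<noteq> y" by auto
        with S(1) xy(1,2) have "1 \<le> hamming_dist twist_space twist n x y"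
          unfolding hamming_separated_def by blast
        then show "1 \<le> hamming_dist Y f n p q"
          by (simp only: xy dist)
      qed
      then have "card (\<iota> ` S) \<le> max_separated Y f n 1"
        by (rule card_le_max_separated[OF Y zero_less_one])
      moreover have "card (\<iota> ` S) = card S"
        using bij sub by (intro card_image) (auto simp: bij_betw_def intro: inj_on_subset)
      ultimately have "sqrt (real n) \<le> real (max_separated Y f n 1)" using S(3) by simp
      moreover have "0 < sqrt (real n)" using elim by simp
      ultimately have "ln (sqrt (real n)) \<le> ln (real (max_separated Y f n 1))"
        by (metis ln_le_cancel_iff order_less_le_trans)
      \<comment> \<open>Here \<open>ln (sqrt n)\<close> is half of \<open>ln n\<close>, which is
        positive because \<open>n \<ge> 2\<close>.\<close>
      then show ?case using elim by (simp add: growth_rate_def ln_sqrt le_divide_eq)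
    qed
  qed
  ultimately show False by (metis ereal_less_eq(3) not_le order_trans zero_ereal_def half_gt_zero zero_less_one)
qed

end
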